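(* $\mathrm{NID}\notin\Sigma_2$.
   Context: Fix a universal prefix-free machine $U$. $K$ denotes prefix-free Kolmogorov complexity and $K(x\mid y)$ conditional prefix-free complexity. For binary strings $x,y$ let $E(x,y)=\max\{K(x\mid y),K(y\mid x)\}$ and $\mathrm{NID}(x,y)=\dfrac{E(x,y)}{\max\{K(x),K(y)\}}$, a rational-valued function on pairs of strings. The oscillation classes for a function $F$ (here with domain pairs of binary strings and values in $\mathbb{Q}$) are defined inductively, where an approximation of $F$ is a computable $f$ with $\lim_{s\to\infty}f(z,s)=F(z)$ for all $z$: $F\in\Sigma_1$ if it has an approximation nondecreasing in $s$; $F\in\Pi_1$ if it has one nonincreasing in $s$; $F\in\Sigma_{n+1}$ if it has a computable approximation $f$ such that for every $z$ there is $s_z$ with $f(z,t)$ nondecreasing for $t<s_z$ and $(f(z,t))_{t\geq s_z}$ behaving as a $\Pi_n$-approximation; $F\in\Pi_{n+1}$ likewise with nonincreasing for $t<s_z$ and $(f(z,t))_{t\geq s_z}$ a $\Sigma_n$-approximation. Thus $\Sigma_n$ (resp. $\Pi_n$) consists of the functions having a computable approximation that changes direction at most $n-1$ times on each input (at most $n$ monotone phases), starting by going up (resp. down). *)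

theory Defs
  imports Complex_Main "HOL-Library.Nat_Bijection" "HOL-Library.Sublist"
begin

datatype recf = Z | S | Proj nat | Comp recf "recf list" | Prec recf recf | Mn recf

inductive reval :: "recf \<Rightarrow> nat list \<Rightarrow> nat \<Rightarrow> bool" where
  zero: "reval Z xs 0"
| succ: "reval S (x # xs) (Suc x)"
| proj: "i < length xs \<Longrightarrow> reval (Proj i) xs (xs ! i)"
| comp: "list_all2 (\<lambda>g y. reval g xs y) gs ys \<Longrightarrow> reval f ys z \<Longrightarrow> reval (Comp f gs) xs z"
| prec0: "reval f xs z \<Longrightarrow> reval (Prec f g) (0 # xs) z"
| precS: "reval (Prec f g) (n # xs) y \<Longrightarrow> reval g (y # n # xs) z
           \<Longrightarrow> reval (Prec f g) (Suc n # xs) z"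
| mn: "reval f (n # xs) 0 \<Longrightarrow> (\<forall>m<n. \<exists>v. reval f (m # xs) v \<and> v > 0)
           \<Longrightarrow> reval (Mn f) xs n"

definition str_code :: "bool list \<Rightarrow> nat" where
  "str_code bs = list_encode (map of_bool bs)"

definition pair_code :: "bool list \<times> bool list \<Rightarrow> nat" where
  "pair_code z = prod_encode (str_code (fst z), str_code (snd z))"

text \<open>Every rational is named by some natural number via this (computable) decoding.\<close>
definition rat_of_code :: "nat \<Rightarrow> rat" where
  "rat_of_code n = (case prod_decode n of (a, b) \<Rightarrow> of_int (int_decode a) / of_nat (Suc b))"

definition partial_computable2 :: "(bool list \<Rightarrow> bool list \<Rightarrow> bool list option) \<Rightarrow> bool" where
  "partial_computable2 M \<longleftrightarrow> (\<exists>r. \<forall>p y n.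
      reval r [str_code p, str_code y] n \<longleftrightarrow> (\<exists>x. M p y = Some x \<and> n = str_code x))"

definition prefix_free_machine :: "(bool list \<Rightarrow> bool list \<Rightarrow> bool list option) \<Rightarrow> bool" where
  "prefix_free_machine M \<longleftrightarrow> partial_computable2 M \<and>
     (\<forall>y p q. M p y \<noteq> None \<longrightarrow> M q y \<noteq> None \<longrightarrow> prefix p q \<longrightarrow> p = q)"

definition universal_pf_machine :: "(bool list \<Rightarrow> bool list \<Rightarrow> bool list option) \<Rightarrow> bool" where
  "universal_pf_machine U \<longleftrightarrow> prefix_free_machine U \<and>
     (\<forall>M. prefix_free_machine M \<longrightarrow> (\<exists>c. \<forall>p y x. M p y = Some x \<longrightarrow>
        (\<exists>q. U q y = Some x \<and> length q \<le> length p + c)))"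

definition Kc :: "(bool list \<Rightarrow> bool list \<Rightarrow> bool list option) \<Rightarrow> bool list \<Rightarrow> bool list \<Rightarrow> nat" where
  "Kc U x y = (LEAST n. \<exists>p. U p y = Some x \<and> length p = n)"

definition K :: "(bool list \<Rightarrow> bool list \<Rightarrow> bool list option) \<Rightarrow> bool list \<Rightarrow> nat" where
  "K U x = Kc U x []"

definition NID :: "(bool list \<Rightarrow> bool list \<Rightarrow> bool list option) \<Rightarrow> bool list \<times> bool list \<Rightarrow> rat" where
  "NID U z = (case z of (x, y) \<Rightarrow>
     of_nat (max (Kc U x y) (Kc U y x)) / of_nat (max (K U x) (K U y)))"

definition computable_approx :: "(bool list \<times> bool list \<Rightarrow> nat \<Rightarrow> rat) \<Rightarrow> bool" where
  "computable_approx f \<longleftrightarrow> (\<exists>r. \<forall>z s. \<exists>n. reval r [pair_code z, s] n \<and> rat_of_code n = f z s)"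

definition is_approx :: "(bool list \<times> bool list \<Rightarrow> nat \<Rightarrow> rat) \<Rightarrow> (bool list \<times> bool list \<Rightarrow> rat) \<Rightarrow> bool" where
  "is_approx f F \<longleftrightarrow> computable_approx f \<and>
     (\<forall>z. (\<lambda>s. real_of_rat (f z s)) \<longlonglongrightarrow> real_of_rat (F z))"

definition Sigma2 :: "(bool list \<times> bool list \<Rightarrow> rat) \<Rightarrow> bool" where
  "Sigma2 F \<longleftrightarrow> (\<exists>f. is_approx f F \<and>
     (\<forall>z. \<exists>sz. (\<forall>t t'. t \<le> t' \<longrightarrow> t' < sz \<longrightarrow> f z t \<le> f z t') \<and>
               (\<forall>t t'. sz \<le> t \<longrightarrow> t \<le> t' \<longrightarrow> f z t' \<le> f z t)))"

end

theory Submission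
  imports Defs
begin

text \<open>
  Let f be an approximation of NID that may only go up and then down. Code numbers by strings of
  ones, and consider pairs x = i and y = \<open>\<langle>i, j, w\<rangle>\<close>. For large random w the value NID(x, y) is at
  least about 1/2, so for all i, j one can compute some w = w(i, j) and a stage at which
  f(x, y) is at least 1/4. From now on w = w(i, j). For \<open>j < 2\<^sup>m\<close> we have K(y | x) \<le> 2m + O(1) and
  K(x | y) = O(1), so for random i much longer than m the value of NID is below 1/4. Hence one can
  compute from m some i such that f(x, y) has dropped below 1/4 for all \<open>j < 2\<^sup>m\<close>, from where it can
  never recover. But now K(x) and K(y) are at most 2m + O(1), while by counting K(y | x) \<ge> m for
  some \<open>j < 2\<^sup>m\<close>, so that NID(x, y) > 1/4 for large m. The factors 2 come from the self-delimiting
  code of a number \<open>k < 2\<^sup>l\<close> as l ones, a zero, and the l binary digits of k; this crude code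
  suffices because the thresholds leave room for constant factors.
\<close>

section \<open>Total recursive functions\<close>

lemma reval_deterministic: "reval r xs v \<Longrightarrow> reval r xs w \<Longrightarrow> v = w"
proof (induction arbitrary: w rule: reval.induct)
  case (zero xs) then show ?case by (auto elim: reval.cases)
next
  case (succ x xs) then show ?case by (auto elim: reval.cases)
next
  case (proj i xs) then show ?case by (auto elim: reval.cases)
next
  case (comp xs gs ys f z)
  from comp.prems obtain ys' where ys': "list_all2 (\<lambda>g y. reval g xs y) gs ys'" "reval f ys' w"
    by (auto elim: reval.cases)
  have "ys = ys'"
    using comp.IH(1) ys'(1) by (auto simp: list_all2_conv_all_nth intro!: nth_equalityI)
  then show ?case using comp.IH(2) ys'(2) by simp
next
  case (prec0 f xs z g) from prec0.prems prec0.IH show ?case by (auto elim: reval.cases)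
next
  case (precS f g n xs y z)
  from precS.prems obtain y' where "reval (Prec f g) (n # xs) y'" "reval g (y' # n # xs) w"
    by (auto elim: reval.cases)
  then show ?case using precS.IH by metis
next
  case (mn f n xs)
  from mn.prems have w: "reval f (w # xs) 0" "\<forall>m<w. \<exists>v. reval f (m # xs) v \<and> v > 0"
    by (auto elim: reval.cases)
  \<comment> \<open>The smaller of two distinct candidates would have both the value 0 and a
    positive value there.\<close>
  have "\<not> w < n" using mn.IH(2) w(1) by fastforce
  moreover have "\<not> n < w" using mn.IH(1) w(2) by fastforce
  ultimately show ?case by simp
qed

section \<open>Composition and primitive recursion\<close>

text \<open>Lists of other lengths are left open, so a function of \<open>k\<close> arguments can be
  any expression in the entries \<open>xs ! i\<close>, and its computability is proved by following
  that expression.\<close>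

definition recursive :: "nat \<Rightarrow> (nat list \<Rightarrow> nat) \<Rightarrow> bool" where
  "recursive k F \<longleftrightarrow> (\<exists>r. \<forall>xs. length xs = k \<longrightarrow> reval r xs (F xs))"

definition "recursive1 f \<longleftrightarrow> recursive 1 (\<lambda>xs. f (xs ! 0))"
definition "recursive2 f \<longleftrightarrow> recursive 2 (\<lambda>xs. f (xs ! 0) (xs ! 1))"
definition "recursive3 f \<longleftrightarrow> recursive 3 (\<lambda>xs. f (xs ! 0) (xs ! 1) (xs ! 2))"

lemma recursive_proj: "i < k \<Longrightarrow> recursive k (\<lambda>xs. xs ! i)"
  unfolding recursive_def by (metis proj)

lemma recursive_comp:
  assumes "recursive (length gs) F" "\<And>g. g \<in> set gs \<Longrightarrow> recursive k g"
  shows "recursive k (\<lambda>xs. F (map (\<lambda>g. g xs) gs))"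
proof -
  obtain r where r: "\<And>xs. length xs = length gs \<Longrightarrow> reval r xs (F xs)"
    using assms(1) unfolding recursive_def by blast
  have "\<forall>g\<in>set gs. \<exists>s. \<forall>xs. length xs = k \<longrightarrow> reval s xs (g xs)"
    using assms(2) unfolding recursive_def by blast
  then obtain s where s: "\<And>g xs. g \<in> set gs \<Longrightarrow> length xs = k \<Longrightarrow> reval (s g) xs (g xs)"
    by metis
  have "reval (Comp r (map s gs)) xs (F (map (\<lambda>g. g xs) gs))" if "length xs = k" for xs
    by (rule reval.comp[where ys = "map (\<lambda>g. g xs) gs"])
      (auto simp: list_all2_conv_all_nth s that intro: r)
  then show ?thesis unfolding recursive_def by blast
qed

lemma recursive1_app:
  assumes "recursive1 f" "recursive k A"
  shows "recursive k (\<lambda>xs. f (A xs))"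
  using recursive_comp[of "[A]" "\<lambda>xs. f (xs ! 0)" k] assms by (simp add: recursive1_def)

lemma recursive2_app:
  assumes "recursive2 f" "recursive k A" "recursive k B"
  shows "recursive k (\<lambda>xs. f (A xs) (B xs))"
  using recursive_comp[of "[A, B]" "\<lambda>xs. f (xs ! 0) (xs ! 1)" k] assms
  by (auto simp: recursive2_def numeral_2_eq_2)

lemma recursive3_app:
  assumes "recursive3 f" "recursive k A" "recursive k B" "recursive k C"
  shows "recursive k (\<lambda>xs. f (A xs) (B xs) (C xs))"
  using recursive_comp[of "[A, B, C]" "\<lambda>xs. f (xs ! 0) (xs ! 1) (xs ! 2)" k] assms
  by (auto simp: recursive3_def numeral_3_eq_3 numeral_2_eq_2)

lemma recursive_Suc:
  assumes "recursive k A"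
  shows "recursive k (\<lambda>xs. Suc (A xs))"
proof (rule recursive1_app[OF _ assms])
  have "reval S xs (Suc (xs ! 0))" if "length xs = 1" for xs
    using that by (cases xs) (auto intro: succ)
  then show "recursive1 Suc" unfolding recursive1_def recursive_def by blast
qed

lemma recursive_const: "recursive k (\<lambda>_. c)"
proof (induction c)
  case 0 show ?case unfolding recursive_def by (metis zero)
next
  case (Suc c) then show ?case by (rule recursive_Suc)
qed

lemma recursive2_primrec:
  assumes "recursive1 g" "recursive3 h"
    and f: "\<And>x. f 0 x = g x" "\<And>n x. f (Suc n) x = h (f n x) n x"
  shows "recursive2 f"
proof -
  obtain rg rh where
    rg: "\<And>xs. length xs = 1 \<Longrightarrow> reval rg xs (g (xs ! 0))" and
    rh: "\<And>xs. length xs = 3 \<Longrightarrow> reval rh xs (h (xs ! 0) (xs ! 1) (xs ! 2))"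
    using assms(1,2) unfolding recursive1_def recursive3_def recursive_def by blast
  have rec: "reval (Prec rg rh) [n, x] (f n x)" for n x
  proof (induction n)
    case 0 show ?case using rg[of "[x]"] f(1) by (auto intro: prec0)
  next
    case (Suc n)
    have "reval rh [f n x, n, x] (f (Suc n) x)" using rh[of "[f n x, n, x]"] f(2) by simp
    then show ?case using Suc by (auto intro: precS)
  qed
  have "reval (Prec rg rh) xs (f (xs ! 0) (xs ! 1))" if "length xs = 2" for xs
    using that rec by (auto simp: length_Suc_conv numeral_2_eq_2)
  then show ?thesis unfolding recursive2_def recursive_def by blast
qed

section \<open>Unbounded search\<close>

text \<open>\<open>Mn\<close> looks for a zero, so the test must return 0 where \<open>P\<close>
  holds. The equivalence also covers divergence: if \<open>P\<close> never holds, the search has no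
  value.\<close>

lemma reval_search_iff:
  assumes "\<And>n. reval r (n # xs) (of_bool (\<not> P n))"
  shows "reval (Mn r) xs n \<longleftrightarrow> P n \<and> (\<forall>m<n. \<not> P m)"
proof
  assume "reval (Mn r) xs n"
  then have n: "reval r (n # xs) 0" "\<forall>m<n. \<exists>v. reval r (m # xs) v \<and> v > 0"
    by (auto elim: reval.cases)
  then show "P n \<and> (\<forall>m<n. \<not> P m)"
    using assms reval_deterministic by (metis less_irrefl of_bool_eq_0_iff)
next
  assume n: "P n \<and> (\<forall>m<n. \<not> P m)"
  then have "reval r (n # xs) 0" using assms[of n] by simp
  moreover have "\<exists>v. reval r (m # xs) v \<and> v > 0" if "m < n" for m
    using assms[of m] n that by (intro exI[of _ 1]) simp
  ultimately show "reval (Mn r) xs n" by (blast intro: mn)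
qed

lemma reval_search_Least:
  assumes "\<And>n. reval r (n # xs) (of_bool (\<not> P n))" "P m"
  shows "reval (Mn r) xs (LEAST n. P n)"
  using reval_search_iff[of r xs P, OF assms(1)] assms(2) by (metis LeastI not_less_Least)

section \<open>Arithmetic and decidable predicates\<close>

definition decidable :: "nat \<Rightarrow> (nat list \<Rightarrow> bool) \<Rightarrow> bool" where
  "decidable k P \<longleftrightarrow> recursive k (\<lambda>xs. of_bool (P xs))"

lemma recursive2_add: "recursive2 (+)"
  by (rule recursive2_primrec[where g = "\<lambda>x. x" and h = "\<lambda>y n x. Suc y"])
    (auto simp: recursive1_def recursive3_def intro!: recursive_Suc recursive_proj)

lemmas recursive_add = recursive2_app[OF recursive2_add]

lemma recursive2_mult: "recursive2 (*)"
  by (rule recursive2_primrec[where g = "\<lambda>x. 0" and h = "\<lambda>y n x. x + y"])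
    (auto simp: recursive1_def recursive3_def intro!: recursive_add recursive_proj recursive_const)

lemmas recursive_mult = recursive2_app[OF recursive2_mult]

text \<open>The recursion rule carries one parameter, so a unary function is treated as a binary one
  with a dummy argument. The predecessor is the recursion that returns its counter.\<close>

lemma recursive_pred:
  assumes "recursive k A"
  shows "recursive k (\<lambda>xs. A xs - 1)"
proof (rule recursive2_app[where f = "\<lambda>n x. n - 1", OF _ assms assms])
  show "recursive2 (\<lambda>n x. n - 1 :: nat)"
    by (rule recursive2_primrec[where g = "\<lambda>x. 0" and h = "\<lambda>y n x. n"])
      (auto simp: recursive1_def recursive3_def intro!: recursive_proj recursive_const)
qed

lemma recursive_diff:
  assumes "recursive k A" "recursive k B"
  shows "recursive k (\<lambda>xs. A xs - B xs)"
proof (rule recursive2_app[where f = "\<lambda>n x. x - n", OF _ assms(2,1)])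
  show "recursive2 (\<lambda>n x. x - n :: nat)"
    by (rule recursive2_primrec[where g = "\<lambda>x. x" and h = "\<lambda>y n x. y - 1"])
      (auto simp: recursive1_def recursive3_def
        intro!: recursive_proj recursive_const recursive_pred[unfolded One_nat_def])
qed

lemma recursive_power2:
  assumes "recursive k A"
  shows "recursive k (\<lambda>xs. 2 ^ A xs)"
proof (rule recursive2_app[where f = "\<lambda>n x. 2 ^ n", OF _ assms assms])
  show "recursive2 (\<lambda>n x. 2 ^ n :: nat)"
    by (rule recursive2_primrec[where g = "\<lambda>x. 1" and h = "\<lambda>y n x. 2 * y"])
      (auto simp: recursive1_def recursive3_def
        intro!: recursive_proj recursive_const recursive_mult)
qed

lemma decidable_not:
  assumes "decidable k P"
  shows "decidable k (\<lambda>xs. \<not> P xs)"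
proof -
  have "(\<lambda>xs. of_bool (\<not> P xs)) = (\<lambda>xs. 1 - of_bool (P xs) :: nat)"
    by (simp add: fun_eq_iff)
  then show ?thesis
    using recursive_diff[OF recursive_const[of k 1]] assms unfolding decidable_def by metis
qed

lemma decidable_conj: "decidable k P \<Longrightarrow> decidable k Q \<Longrightarrow> decidable k (\<lambda>xs. P xs \<and> Q xs)"
  unfolding decidable_def of_bool_conj by (rule recursive_mult)

lemma decidable_less:
  assumes "recursive k A" "recursive k B"
  shows "decidable k (\<lambda>xs. A xs < B xs)"
proof -
  \<comment> \<open>With truncated subtraction, \<open>1 - (1 - d)\<close> is 1 for positive
    \<open>d\<close> and 0 for \<open>d = 0\<close>.\<close>
  have "(\<lambda>xs. of_bool (A xs < B xs)) = (\<lambda>xs. 1 - (1 - (B xs - A xs)))"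
    by (auto simp: fun_eq_iff)
  then show ?thesis
    unfolding decidable_def by (simp only:) (intro recursive_diff recursive_const assms)
qed

lemma decidable_le:
  assumes "recursive k A" "recursive k B"
  shows "decidable k (\<lambda>xs. A xs \<le> B xs)"
  using decidable_not[OF decidable_less[OF assms(2,1)]] by (simp add: not_less)

lemma decidable_eq:
  assumes "recursive k A" "recursive k B"
  shows "decidable k (\<lambda>xs. A xs = B xs)"
  using decidable_conj[OF decidable_le[OF assms] decidable_le[OF assms(2,1)]]
  by (simp add: eq_iff)

lemma recursive1_Least:
  assumes "decidable 2 (\<lambda>xs. P (xs ! 0) (xs ! 1))" "\<And>x. \<exists>n. P n x"
  shows "recursive1 (\<lambda>x. LEAST n. P n x)"
proof -
  obtain r where r: "\<And>xs. length xs = 2 \<Longrightarrow> reval r xs (of_bool (\<not> P (xs ! 0) (xs ! 1)))"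
    using decidable_not[OF assms(1)] unfolding decidable_def recursive_def by blast
  have "reval (Mn r) xs (LEAST n. P n (xs ! 0))" if "length xs = 1" for xs
    using assms(2)[of "xs ! 0"] that r[of "_ # xs"]
    by (auto intro!: reval_search_Least)
  then show ?thesis unfolding recursive1_def recursive_def by blast
qed

lemma recursive2_Least:
  assumes "decidable 3 (\<lambda>xs. P (xs ! 0) (xs ! 1) (xs ! 2))" "\<And>x y. \<exists>n. P n x y"
  shows "recursive2 (\<lambda>x y. LEAST n. P n x y)"
proof -
  obtain r where r:
    "\<And>xs. length xs = 3 \<Longrightarrow> reval r xs (of_bool (\<not> P (xs ! 0) (xs ! 1) (xs ! 2)))"
    using decidable_not[OF assms(1)] unfolding decidable_def recursive_def by blast
  have "reval (Mn r) xs (LEAST n. P n (xs ! 0) (xs ! 1))" if "length xs = 2" for xs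
    using assms(2)[of "xs ! 0" "xs ! 1"] that r[of "_ # xs"]
    by (auto intro!: reval_search_Least simp: numeral_2_eq_2)
  then show ?thesis unfolding recursive2_def recursive_def by blast
qed

text \<open>The bounded quantifier is a product of truth values, computed by recursion on the
  bound.\<close>

lemma decidable_ball_less:
  assumes "decidable 2 (\<lambda>xs. P (xs ! 0) (xs ! 1))" "recursive k B" "recursive k X"
  shows "decidable k (\<lambda>xs. \<forall>j<B xs. P j (X xs))"
  unfolding decidable_def
proof (rule recursive2_app[where f = "\<lambda>b x. of_bool (\<forall>j<b. P j x)", OF _ assms(2,3)])
  have P: "recursive2 (\<lambda>j x. of_bool (P j x))"
    using assms(1) unfolding decidable_def recursive2_def .
  show "recursive2 (\<lambda>b x. of_bool (\<forall>j<b. P j x))"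
    by (rule recursive2_primrec[where g = "\<lambda>x. 1" and h = "\<lambda>y n x. y * of_bool (P n x)"])
      (auto simp: recursive1_def recursive3_def less_Suc_eq
        intro!: recursive_proj recursive_const recursive_mult recursive2_app[OF P])
qed

section \<open>The pairing function and its inverses\<close>

lemma recursive_triangle:
  assumes "recursive k A"
  shows "recursive k (\<lambda>xs. triangle (A xs))"
proof (rule recursive2_app[where f = "\<lambda>n x. triangle n", OF _ assms assms])
  show "recursive2 (\<lambda>n x. triangle n)"
    by (rule recursive2_primrec[where g = "\<lambda>x. 0" and h = "\<lambda>y n x. y + Suc n"])
      (auto simp: recursive1_def recursive3_def
        intro!: recursive_proj recursive_const recursive_add recursive_Suc)
qed

lemma recursive_prod_encode:
  assumes "recursive k A" "recursive k B"
  shows "recursive k (\<lambda>xs. prod_encode (A xs, B xs))"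
  unfolding prod_encode_def prod.case
  by (intro recursive_add recursive_triangle assms)

text \<open>\<open>prod_encode\<close> lists the pairs diagonal by diagonal: those with sum
  \<open>s\<close> fill the codes from \<open>triangle s\<close> up to but excluding
  \<open>triangle (Suc s)\<close>. The search thus recovers the sum.\<close>

lemma Least_triangle: "(LEAST s. prod_encode (a, b) < triangle (Suc s)) = a + b"
proof (rule Least_equality)
  show "prod_encode (a, b) < triangle (Suc (a + b))" by (simp add: prod_encode_def)
next
  fix s assume s: "prod_encode (a, b) < triangle (Suc s)"
  have mono: "mono triangle" unfolding mono_iff_le_Suc by simp
  show "a + b \<le> s"
  proof (rule ccontr)
    assume "\<not> a + b \<le> s"
    then have "triangle (Suc s) \<le> triangle (a + b)" by (intro monoD[OF mono]) simp
    then show False using s by (simp add: prod_encode_def)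
  qed
qed

definition diagonal_index :: "nat \<Rightarrow> nat" where
  "diagonal_index n = (LEAST s. n < triangle (Suc s))"

lemma recursive1_diagonal_index: "recursive1 diagonal_index"
  unfolding diagonal_index_def
proof (rule recursive1_Least)
  show "decidable 2 (\<lambda>xs. xs ! 1 < triangle (Suc (xs ! 0)))"
    by (intro decidable_less recursive_triangle recursive_Suc recursive_proj) auto
  fix x show "\<exists>n. x < triangle (Suc n)"
    by (rule exI[of _ x]) simp
qed

text \<open>A pair with sum \<open>d\<close> has as its code \<open>triangle d\<close> plus its
  first component.\<close>

lemma fst_prod_decode: "fst (prod_decode n) = n - triangle (diagonal_index n)"
  and snd_prod_decode: "snd (prod_decode n) = diagonal_index n - fst (prod_decode n)"
proof -
  obtain a b where n: "n = prod_encode (a, b)"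
    using prod_decode_inverse[of n] by (cases "prod_decode n") auto
  have d: "diagonal_index n = a + b" unfolding n diagonal_index_def by (rule Least_triangle)
  show "fst (prod_decode n) = n - triangle (diagonal_index n)"
    unfolding d by (simp add: n) (simp add: prod_encode_def)
  show "snd (prod_decode n) = diagonal_index n - fst (prod_decode n)"
    unfolding d by (simp add: n)
qed

lemma recursive_fst_decode:
  assumes "recursive k A"
  shows "recursive k (\<lambda>xs. fst (prod_decode (A xs)))"
  unfolding fst_prod_decode
  by (intro recursive_diff recursive_triangle recursive1_app[OF recursive1_diagonal_index] assms)

lemma recursive_snd_decode:
  assumes "recursive k A"
  shows "recursive k (\<lambda>xs. snd (prod_decode (A xs)))"
  unfolding snd_prod_decode
  by (intro recursive_diff recursive_fst_decode recursive1_app[OF recursive1_diagonal_index] assms)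

text \<open>The quotient is found as the least \<open>q\<close> with
  \<open>x < Suc q * 2 ^ y\<close>. A power of two is positive, so the search always ends.\<close>

lemma recursive_div_power2:
  assumes "recursive k A" "recursive k B"
  shows "recursive k (\<lambda>xs. A xs div 2 ^ B xs)"
proof (rule recursive2_app[OF _ assms])
  have "x div 2 ^ y = (LEAST q. x < Suc q * 2 ^ y)" for x y :: nat
  proof (rule Least_equality[symmetric])
    show "x < Suc (x div 2 ^ y) * 2 ^ y"
      using dividend_less_div_times[of "2 ^ y" x] by simp
    show "x div 2 ^ y \<le> q" if "x < Suc q * 2 ^ y" for q
      using that by (simp add: less_mult_imp_div_less flip: less_Suc_eq_le)
  qed
  moreover have "recursive2 (\<lambda>x y. LEAST q. x < Suc q * 2 ^ y)"
  proof (rule recursive2_Least)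
    show "decidable 3 (\<lambda>xs. xs ! 1 < Suc (xs ! 0) * 2 ^ (xs ! 2))"
      by (intro decidable_less recursive_mult recursive_power2 recursive_Suc recursive_proj) auto
    fix x y :: nat show "\<exists>n. x < Suc n * 2 ^ y"
      using dividend_less_div_times[of "2 ^ y" x] by (intro exI[of _ "x div 2 ^ y"]) simp
  qed
  ultimately show "recursive2 (\<lambda>x y. x div 2 ^ y)" by simp
qed

lemma recursive_div_2: "recursive k A \<Longrightarrow> recursive k (\<lambda>xs. A xs div 2)"
  using recursive_div_power2[OF _ recursive_const[of k 1]] by simp

lemma recursive_mod_2:
  assumes "recursive k A" shows "recursive k (\<lambda>xs. A xs mod 2)"
  unfolding modulo_nat_def by (intro recursive_diff recursive_mult recursive_div_2 recursive_const assms)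

lemmas recursive_intros =
  recursive_proj recursive_const recursive_Suc recursive_add recursive_mult recursive_diff
  recursive_power2 recursive_prod_encode recursive_fst_decode recursive_snd_decode
  recursive_div_power2 recursive_div_2 recursive_mod_2
  decidable_not decidable_conj decidable_less decidable_le decidable_eq


section \<open>A prefix-free machine for every recursive function\<close>

abbreviation ones :: "nat \<Rightarrow> bool list" where
  "ones k \<equiv> replicate k True"

lemma str_code_Nil: "str_code [] = 0"
  and str_code_Cons: "str_code (b # bs) = Suc (prod_encode (of_bool b, str_code bs))"
  by (simp_all add: str_code_def)

lemma str_code_inject: "str_code p = str_code q \<longleftrightarrow> p = q"
proof -
  have "inj (of_bool :: bool \<Rightarrow> nat)" by (auto intro: injI simp: of_bool_def split: if_splits)
  then show ?thesis by (simp add: str_code_def list_encode_eq inj_map_eq_map)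
qed

lemma recursive_prepend_ones:
  assumes "recursive k A" "recursive k (\<lambda>xs. str_code (P xs))"
  shows "recursive k (\<lambda>xs. str_code (ones (A xs) @ P xs))"
proof -
  \<comment> \<open>The effect on a string code of putting one \<open>True\<close> in front.\<close>
  let ?F = "\<lambda>c. Suc (prod_encode (1, c))"
  have "str_code (ones a @ p) = (?F ^^ a) (str_code p)" for a p
    by (induction a) (simp_all add: str_code_Cons)
  moreover have "recursive2 (\<lambda>a. ?F ^^ a)"
    by (rule recursive2_primrec[where g = "\<lambda>x. x" and h = "\<lambda>y n x. ?F y"])
      (auto simp: recursive1_def recursive3_def intro!: recursive_intros)
  ultimately show ?thesis
    using recursive2_app[OF _ assms] by simp
qed

lemma recursive_ones: "recursive k A \<Longrightarrow> recursive k (\<lambda>xs. str_code (ones (A xs)))"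
  using recursive_prepend_ones[of k A "\<lambda>_. []"] recursive_const by simp

section \<open>Self-delimiting programs\<close>

fun bits :: "nat \<Rightarrow> nat \<Rightarrow> bool list" where
  "bits 0 k = []"
| "bits (Suc l) k = odd (k div 2 ^ l) # bits l k"

lemma length_bits [simp]: "length (bits l k) = l"
  by (induction l) auto

text \<open>The leading digit is the parity of \<open>k div 2 ^ l\<close>; with the residue modulo
  \<open>2 ^ l\<close> it determines the residue modulo \<open>2 ^ Suc l\<close>.\<close>

lemma bits_eqD: "bits l k = bits l k' \<Longrightarrow> k mod 2 ^ l = k' mod 2 ^ l"
proof (induction l)
  case (Suc l)
  have "k mod (2 ^ l * 2) = 2 ^ l * (k div 2 ^ l mod 2) + k mod 2 ^ l" for k :: nat
    by (rule mod_mult2_eq)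
  moreover have "k div 2 ^ l mod 2 = k' div 2 ^ l mod 2"
    using Suc.prems by (simp add: mod2_eq_if)
  ultimately show ?case using Suc by (simp add: mult.commute)
qed simp

lemma recursive_bits:
  assumes "recursive k A" "recursive k B"
  shows "recursive k (\<lambda>xs. str_code (bits (A xs) (B xs)))"
proof (rule recursive2_app[OF _ assms])
  show "recursive2 (\<lambda>l n. str_code (bits l n))"
    by (rule recursive2_primrec[where g = "\<lambda>x. 0"
          and h = "\<lambda>y n x. Suc (prod_encode ((x div 2 ^ n) mod 2, y))"])
      (auto simp: recursive1_def recursive3_def str_code_Nil str_code_Cons
        simp flip: mod_2_eq_odd simp del: One_nat_def intro!: recursive_intros)
qed

text \<open>The ones announce how many digits follow the zero, so the string marks its own end.
  Digits of \<open>k\<close> beyond the lowest \<open>l\<close> are lost, hence the condition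
  \<open>k < 2 ^ l\<close> where decoding matters.\<close>

definition program :: "nat \<Rightarrow> nat \<Rightarrow> bool list" where
  "program l k = ones l @ False # bits l k"

lemma length_program [simp]: "length (program l k) = 2 * l + 1"
  by (simp add: program_def)

lemma recursive_program:
  assumes "recursive k A" "recursive k B"
  shows "recursive k (\<lambda>xs. str_code (program (A xs) (B xs)))"
  unfolding program_def
  by (rule recursive_prepend_ones[OF assms(1)])
    (simp add: str_code_Cons, intro recursive_intros recursive_bits assms)

lemma prefix_ones_FalseD:
  "prefix (ones l @ False # p) (ones l' @ False # p') \<Longrightarrow> l = l' \<and> prefix p p'"
proof (induction l arbitrary: l')
  case 0 then show ?case by (cases l') auto
next
  case (Suc l) then show ?case by (cases l') auto
qed

text \<open>The first zero fixes the number of digits that follow, and of two digit strings of equal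
  length one is a prefix of the other only if they are equal.\<close>

lemma prefix_programD: "prefix (program l k) (program l' k') \<Longrightarrow> program l k = program l' k'"
  using prefix_ones_FalseD[of l "bits l k" l' "bits l' k'"]
    not_equal_is_parallel[of "bits l k" "bits l' k'"]
  by (auto simp: program_def)

lemma program_inject:
  assumes "program l k = program l' k'" "k < 2 ^ l" "k' < 2 ^ l'"
  shows "l = l' \<and> k = k'"
  using assms prefix_ones_FalseD[of l "bits l k" l' "bits l' k'"] bits_eqD[of l k k']
  by (auto simp: program_def)

text \<open>A prefix-free machine decodes \<open>program l k\<close> and, under the condition
  \<open>ones a\<close>, prints \<open>ones (\<phi> l k a)\<close>; by universality \<open>U\<close>
  simulates it with programs longer by at most a constant.\<close>

lemma universal_upper_bound:
  assumes U: "universal_pf_machine U" and \<phi>: "recursive3 \<phi>"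
  obtains c where
    "\<And>l k a. k < 2 ^ l \<Longrightarrow> \<exists>q. U q (ones a) = Some (ones (\<phi> l k a)) \<and> length q \<le> 2 * l + c"
proof -
  define l where "l n = fst (prod_decode (fst (prod_decode n)))" for n
  define k where "k n = snd (prod_decode (fst (prod_decode n)))" for n
  define a where "a n = snd (prod_decode n)" for n
  \<comment> \<open>\<open>n\<close> codes a triple of \<open>l\<close>, \<open>k\<close> and
    \<open>a\<close>, and \<open>T\<close> tests whether this triple encodes to the given input.
    Decoding by search requires only the encoding to be computable.\<close>
  define T where "T n p y \<longleftrightarrow> str_code (program (l n) (k n)) = p \<and> k n < 2 ^ l n \<and> str_code (ones (a n)) = y"
    for n p y
  define H where "H n = \<phi> (l n) (k n) (a n)" for n
  define M where "M p y = (if \<exists>n. T n (str_code p) (str_code y)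
      then Some (ones (H (LEAST n. T n (str_code p) (str_code y)))) else None)" for p y
  have "decidable 3 (\<lambda>xs. T (xs ! 0) (xs ! 1) (xs ! 2))"
    unfolding T_def l_def k_def a_def
    by (intro recursive_intros recursive_program recursive_ones) auto
  from decidable_not[OF this] obtain rT where rT:
    "\<And>xs. length xs = 3 \<Longrightarrow> reval rT xs (of_bool (\<not> T (xs ! 0) (xs ! 1) (xs ! 2)))"
    unfolding decidable_def recursive_def by blast
  have rT: "reval rT [n, p, y] (of_bool (\<not> T n p y))" for n p y
    using rT[of "[n, p, y]"] by simp
  have "recursive 1 (\<lambda>xs. str_code (ones (H (xs ! 0))))"
    unfolding H_def l_def k_def a_def
    by (intro recursive_intros recursive3_app[OF \<phi>] recursive_ones) auto
  then obtain rH where rH: "\<And>xs. length xs = 1 \<Longrightarrow> reval rH xs (str_code (ones (H (xs ! 0))))"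
    unfolding recursive_def by blast
  have rH: "reval rH [n] v \<longleftrightarrow> v = str_code (ones (H n))" for n v
    using rH[of "[n]"] reval_deterministic by fastforce
  have search: "reval (Mn rT) [p, y] n \<longleftrightarrow> T n p y \<and> (\<forall>m<n. \<not> T m p y)" for p y n
    by (rule reval_search_iff) (rule rT)
  \<comment> \<open>Both directions matter: the composition must diverge exactly where
    \<open>M\<close> is \<open>None\<close>.\<close>
  have comp_iff: "reval (Comp rH [Mn rT]) xs v \<longleftrightarrow> (\<exists>n. reval (Mn rT) xs n \<and> reval rH [n] v)"
    for xs v
  proof
    assume "reval (Comp rH [Mn rT]) xs v"
    then show "\<exists>n. reval (Mn rT) xs n \<and> reval rH [n] v"
      by cases (auto simp: list_all2_Cons1)
  qed (auto intro!: reval.comp[where ys = "[_]"])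
  have Least: "T n p y \<and> (\<forall>m<n. \<not> T m p y) \<longleftrightarrow> (\<exists>n. T n p y) \<and> n = (LEAST n. T n p y)" for n p y
    by (metis LeastI not_less_Least linorder_neqE_nat)
  have "partial_computable2 M"
    unfolding partial_computable2_def
    by (rule exI[of _ "Comp rH [Mn rT]"]) (auto simp: comp_iff search Least rH M_def)
  moreover have "p = q" if M: "M p y \<noteq> None" "M q y \<noteq> None" and "prefix p q" for p q y
  proof -
    obtain n n' where "T n (str_code p) (str_code y)" "T n' (str_code q) (str_code y)"
      using M unfolding M_def by metis
    then have "p = program (l n) (k n)" "q = program (l n') (k n')"
      by (auto simp: T_def str_code_inject)
    then show ?thesis using prefix_programD \<open>prefix p q\<close> by blast
  qed
  ultimately have "prefix_free_machine M" unfolding prefix_free_machine_def by blast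
  then obtain c where c: "\<And>p y x. M p y = Some x \<Longrightarrow> \<exists>q. U q y = Some x \<and> length q \<le> length p + c"
    using U unfolding universal_pf_machine_def by blast
  have "M (program l' k') (ones a') = Some (ones (\<phi> l' k' a'))" if "k' < 2 ^ l'" for l' k' a'
  proof -
    let ?T = "\<lambda>n. T n (str_code (program l' k')) (str_code (ones a'))"
    have T: "?T (prod_encode (prod_encode (l', k'), a'))"
      using that by (simp add: T_def l_def k_def a_def)
    \<comment> \<open>The search returns some triple that encodes to the same input; injectivity of
      the encoding makes its components the given ones.\<close>
    then have "?T (LEAST n. ?T n)" by (rule LeastI)
    then have "l (LEAST n. ?T n) = l' \<and> k (LEAST n. ?T n) = k'" "a (LEAST n. ?T n) = a'"
      using program_inject[OF _ _ that] unfolding T_def str_code_inject by auto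
    then show ?thesis using T by (auto simp: M_def H_def)
  qed
  \<comment> \<open>The additional 1 pays for the zero between the two blocks of a program.\<close>
  then have "\<exists>q. U q (ones a) = Some (ones (\<phi> l k a)) \<and> length q \<le> 2 * l + (c + 1)"
    if "k < 2 ^ l" for l k a
    using c[of "program l k" "ones a"] that by fastforce
  then show thesis by (rule that)
qed

section \<open>Bounds on complexities and on the normalized information distance\<close>

lemma Kc_le: "U p y = Some x \<Longrightarrow> Kc U x y \<le> length p"
  unfolding Kc_def by (rule Least_le) blast

lemma Kc_attained:
  assumes "U p y = Some x"
  obtains q where "U q y = Some x" "length q = Kc U x y"
  using LeastI_ex[of "\<lambda>n. \<exists>p. U p y = Some x \<and> length p = n"] assms unfolding Kc_def by blast

text \<open>The strings of length \<open>m\<close> add \<open>2 ^ m\<close>, so the bound doubles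
  and stays strict, as the pigeonhole argument requires.\<close>

lemma card_lists_shorter: "card {p :: bool list. length p < m} < 2 ^ m"
  and finite_lists_shorter: "finite {p :: bool list. length p < m}"
proof (induction m)
  case 0
  { case 1 show ?case by simp next case 2 show ?case by simp }
next
  case (Suc m)
  have eq: "{p :: bool list. length p < Suc m} = {p. length p < m} \<union> {p. length p = m}"
    by auto
  have fin: "finite {p :: bool list. length p = m}" and card: "card {p :: bool list. length p = m} = 2 ^ m"
    using card_lists_length_eq[of "UNIV :: bool set" m] finite_lists_length_eq[of "UNIV :: bool set" m]
    by simp_all
  { case 1 show ?case unfolding eq using Suc fin card by (subst card_Un_disjoint) auto
  next case 2 show ?case unfolding eq using Suc fin by simp }
qed

text \<open>Pigeonhole: one program prints at most one string under the condition \<open>y\<close>,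
  and there are too few programs shorter than \<open>m\<close> for \<open>2 ^ m\<close> distinct
  outputs.\<close>

lemma ex_incompressible:
  fixes g :: "nat \<Rightarrow> bool list"
  assumes "inj_on g {..<2 ^ m}" "\<And>j. j < 2 ^ m \<Longrightarrow> \<exists>q. U q y = Some (g j)"
  shows "\<exists>j<2 ^ m. m \<le> Kc U (g j) y"
proof (rule ccontr)
  assume "\<not> ?thesis"
  then have less: "Kc U (g j) y < m" if "j < 2 ^ m" for j using that by (auto simp: not_le)
  have "\<exists>q. U q y = Some (g j) \<and> length q < m" if j: "j < 2 ^ m" for j
  proof -
    obtain p where "U p y = Some (g j)" using assms(2)[OF j] by blast
    then obtain q where "U q y = Some (g j)" "length q = Kc U (g j) y" by (rule Kc_attained)
    then show ?thesis using less[OF j] by auto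
  qed
  then obtain q where q: "\<And>j. j < 2 ^ m \<Longrightarrow> U (q j) y = Some (g j) \<and> length (q j) < m"
    by metis
  have "inj_on q {..<2 ^ m}"
  proof (rule inj_onI)
    fix j j' assume j: "j \<in> {..<2 ^ m}" "j' \<in> {..<2 ^ m}" and "q j = q j'"
    then have "Some (g j) = Some (g j')" using q[of j] q[of j'] by simp
    then show "j = j'" using assms(1) j by (auto dest: inj_onD)
  qed
  moreover have "q ` {..<2 ^ m} \<subseteq> {p. length p < m}" using q by auto
  ultimately have "card {..<2 ^ m :: nat} \<le> card {p :: bool list. length p < m}"
    using finite_lists_shorter by (rule card_inj_on_le)
  then show False using card_lists_shorter[of m] by simp
qed

section \<open>Thresholds for the distance and strings of ones\<close>

lemma NID_gt:
  assumes "x \<noteq> y" "U p [] = Some x" "U q [] = Some y"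
    and "m \<le> Kc U y x" "K U x \<le> B" "K U y \<le> B" "B < 4 * m"
  shows "1 / 4 < NID U (x, y)"
proof -
  obtain p' where p': "U p' [] = Some x" "length p' = K U x"
    unfolding K_def by (rule Kc_attained[where U = U and p = p and y = "[]" and x = x, OF assms(2)])
  obtain q' where q': "U q' [] = Some y" "length q' = K U y"
    unfolding K_def by (rule Kc_attained[where U = U and p = q and y = "[]" and x = y, OF assms(3)])
  \<comment> \<open>The empty program prints only one string under the empty condition, so distinct
    strings cannot both have complexity 0. This keeps the denominator positive.\<close>
  have "\<not> (K U x = 0 \<and> K U y = 0)"
    using p' q' assms(1) by force
  then have "0 < max (K U x) (K U y)" by linarith
  moreover have "max (K U x) (K U y) < 4 * max (Kc U x y) (Kc U y x)"
    using assms(4-7) by linarith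
  then have "of_nat (max (K U x) (K U y)) < (of_nat (4 * max (Kc U x y) (Kc U y x)) :: rat)"
    by (rule of_nat_less_iff[THEN iffD2])
  ultimately show ?thesis by (simp add: NID_def divide_simps)
qed

lemma NID_less:
  assumes "Kc U x y \<le> A" "Kc U y x \<le> A" "4 * A < K U x"
  shows "NID U (x, y) < 1 / 4"
proof -
  have "0 < max (K U x) (K U y)" "4 * max (Kc U x y) (Kc U y x) < max (K U x) (K U y)"
    using assms by linarith+
  then have "of_nat (4 * max (Kc U x y) (Kc U y x)) < (of_nat (max (K U x) (K U y)) :: rat)"
    by (intro of_nat_less_iff[THEN iffD2])
  with \<open>0 < max (K U x) (K U y)\<close> show ?thesis by (simp add: NID_def divide_simps)
qed

text \<open>Universality applied to a constant function. It ensures that the minima defining the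
  complexities of strings of ones are attained.\<close>

lemma ex_program:
  assumes "universal_pf_machine U"
  shows "\<exists>q. U q (ones a) = Some (ones b)"
proof -
  have "recursive3 (\<lambda>l k a. b)" unfolding recursive3_def by (rule recursive_const)
  from universal_upper_bound[OF assms this] show ?thesis
    by (metis less_numeral_extra(1) power_0)
qed

lemma ex_program_Nil:
  assumes "universal_pf_machine U"
  shows "\<exists>q. U q [] = Some (ones b)"
  using ex_program[OF assms, of 0] by simp

lemma Kc_ones_upper_bound:
  assumes "universal_pf_machine U" "recursive3 \<phi>"
  obtains c where "\<And>l k a. k < 2 ^ l \<Longrightarrow> Kc U (ones (\<phi> l k a)) (ones a) \<le> 2 * l + c"
proof -
  obtain c where c:
    "\<And>l k a. k < 2 ^ l \<Longrightarrow> \<exists>q. U q (ones a) = Some (ones (\<phi> l k a)) \<and> length q \<le> 2 * l + c"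
    using universal_upper_bound[OF assms] by blast
  have "Kc U (ones (\<phi> l k a)) (ones a) \<le> 2 * l + c" if "k < 2 ^ l" for l k a
    using c[OF that, of a] Kc_le le_trans by blast
  then show thesis by (rule that)
qed

lemma K_ones_upper_bound:
  assumes "universal_pf_machine U" "recursive2 \<phi>"
  obtains c where "\<And>l k. k < 2 ^ l \<Longrightarrow> K U (ones (\<phi> l k)) \<le> 2 * l + c"
proof -
  have "recursive3 (\<lambda>l k a. \<phi> l k)"
    unfolding recursive3_def by (intro recursive2_app[OF assms(2)] recursive_proj) auto
  then obtain c where c: "\<And>l k a. k < 2 ^ l \<Longrightarrow> Kc U (ones (\<phi> l k)) (ones a) \<le> 2 * l + c"
    using Kc_ones_upper_bound[OF assms(1)] by blast
  \<comment> \<open>The empty condition is \<open>ones 0\<close>.\<close>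
  show thesis
    by (rule that[of c]) (use c[of _ _ 0] in \<open>simp add: K_def\<close>)
qed

lemma ex_Kc_ones_ge:
  fixes g :: "nat \<Rightarrow> nat"
  assumes "universal_pf_machine U" "inj g"
  shows "\<exists>j<2 ^ m. m \<le> Kc U (ones (g j)) (ones a)"
proof (rule ex_incompressible[where g = "\<lambda>j. ones (g j)"])
  show "inj_on (\<lambda>j. ones (g j)) {..<2 ^ m}"
    using assms(2) by (auto simp: inj_on_def)
  show "\<exists>q. U q (ones a) = Some (ones (g j))" for j
    by (rule ex_program[OF assms(1)])
qed

section \<open>Three estimates of the distance\<close>

text \<open>Among \<open>w < 2 ^ l\<close> some \<open>g w\<close> has conditional complexity at
  least \<open>l\<close>, while all have complexity at most \<open>2 * l + c\<close>; for large
  \<open>l\<close> the ratio is close to 1/2 or more. This makes the search for \<open>w\<close>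
  succeed.\<close>

lemma NID_gt_ex:
  assumes U: "universal_pf_machine U" and g: "recursive1 g" "inj g" "\<And>w. g w \<noteq> i"
  shows "\<exists>w. 1 / 4 < NID U (ones i, ones (g w))"
proof -
  have "recursive2 (\<lambda>l k. g k)"
    unfolding recursive2_def by (intro recursive1_app[OF g(1)] recursive_proj) auto
  then obtain c where c: "\<And>l k. k < 2 ^ l \<Longrightarrow> K U (ones (g k)) \<le> 2 * l + c"
    by (rule K_ones_upper_bound[OF U, where \<phi> = "\<lambda>l k. g k"]) blast
  \<comment> \<open>With this choice \<open>B\<close> below equals \<open>3 * l - 1\<close>, which
    is less than \<open>4 * l\<close>.\<close>
  define l where "l = c + K U (ones i) + 1"
  obtain w where w: "w < 2 ^ l" "l \<le> Kc U (ones (g w)) (ones i)"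
    using ex_Kc_ones_ge[OF U g(2)] by blast
  obtain p q where "U p [] = Some (ones i)" "U q [] = Some (ones (g w))"
    using ex_program_Nil[OF U] by metis
  moreover have "ones i \<noteq> ones (g w)" using g(3)[of w] by auto
  ultimately have "1 / 4 < NID U (ones i, ones (g w))"
    using w c[OF w(1)] by (intro NID_gt[where m = l and B = "2 * l + c + K U (ones i)"]) (auto simp: l_def)
  then show ?thesis by blast
qed

text \<open>Given \<open>i\<close>, the string for \<open>y i j\<close> costs only a program for
  \<open>j\<close>, and \<open>h\<close> recovers \<open>i\<close> at constant cost. Both
  conditional complexities are bounded independently of \<open>i\<close>, so a complex enough
  \<open>i\<close> makes the ratio small.\<close>

lemma NID_less_ex:
  assumes U: "universal_pf_machine U"
    and y: "recursive2 y" and h: "recursive1 h" and hy: "\<And>i j. h (y i j) = i"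
  shows "\<exists>i. \<forall>j<2 ^ m. NID U (ones i, ones (y i j)) < 1 / 4"
proof -
  have "recursive3 (\<lambda>l k a. y a k)"
    unfolding recursive3_def by (intro recursive2_app[OF y] recursive_proj) auto
  then obtain c where c: "\<And>l k a. k < 2 ^ l \<Longrightarrow> Kc U (ones (y a k)) (ones a) \<le> 2 * l + c"
    by (rule Kc_ones_upper_bound[OF U, where \<phi> = "\<lambda>l k a. y a k"]) blast
  have "recursive3 (\<lambda>l k a. h a)"
    unfolding recursive3_def by (intro recursive1_app[OF h] recursive_proj) auto
  then obtain d where d: "\<And>l (k::nat) a. k < 2 ^ l \<Longrightarrow> Kc U (ones (h a)) (ones a) \<le> 2 * l + d"
    by (rule Kc_ones_upper_bound[OF U, where \<phi> = "\<lambda>l k a. h a"]) blast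
  define n where "n = 4 * (2 * m + c + d) + 1"
  obtain i where "n \<le> Kc U (ones i) (ones 0)"
    using ex_Kc_ones_ge[OF U inj_on_id, of n 0] by auto
  then have i: "n \<le> K U (ones i)" by (simp add: K_def)
  \<comment> \<open>Recovering \<open>i\<close> takes no further information, so the bound
    \<open>d\<close> is used with \<open>l = k = 0\<close>.\<close>
  have "NID U (ones i, ones (y i j)) < 1 / 4" if "j < 2 ^ m" for j
    using c[OF that, of i] d[of 0 0 "y i j"] hy[of i j] i
    by (intro NID_less[where A = "2 * m + c + d"]) (auto simp: n_def)
  then show ?thesis by blast
qed

text \<open>A program with \<open>l = m\<close> and \<open>k = j\<close> conveys \<open>m\<close> by
  its number of digits and \<open>j\<close> by the digits themselves, so \<open>2 * m + O(1)\<close>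
  bits describe \<open>I m\<close> as well as \<open>y (I m) j\<close>. Counting supplies a
  \<open>j\<close> with conditional complexity at least \<open>m\<close>.\<close>

lemma NID_gt_ex_star:
  assumes U: "universal_pf_machine U"
    and I: "recursive1 I" and y: "recursive2 y" "\<And>i. inj (y i)" "\<And>i j. y i j \<noteq> i"
  shows "\<exists>m. \<exists>j<2 ^ m. 1 / 4 < NID U (ones (I m), ones (y (I m) j))"
proof -
  have "recursive2 (\<lambda>l k. I l)"
    unfolding recursive2_def by (intro recursive1_app[OF I] recursive_proj) auto
  then obtain c where c: "\<And>l (k::nat). k < 2 ^ l \<Longrightarrow> K U (ones (I l)) \<le> 2 * l + c"
    by (rule K_ones_upper_bound[OF U, where \<phi> = "\<lambda>l k. I l"]) blast
  have "recursive2 (\<lambda>l k. y (I l) k)"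
    unfolding recursive2_def by (intro recursive2_app[OF y(1)] recursive1_app[OF I] recursive_proj) auto
  then obtain d where d: "\<And>l k. k < 2 ^ l \<Longrightarrow> K U (ones (y (I l) k)) \<le> 2 * l + d"
    by (rule K_ones_upper_bound[OF U, where \<phi> = "\<lambda>l k. y (I l) k"]) blast
  \<comment> \<open>Now \<open>B\<close> below equals \<open>3 * m - 1\<close>, which is less than
    \<open>4 * m\<close>.\<close>
  define m where "m = c + d + 1"
  obtain j where j: "j < 2 ^ m" "m \<le> Kc U (ones (y (I m) j)) (ones (I m))"
    using ex_Kc_ones_ge[OF U y(2)] by blast
  obtain p q where "U p [] = Some (ones (I m))" "U q [] = Some (ones (y (I m) j))"
    using ex_program_Nil[OF U] by metis
  moreover have "ones (I m) \<noteq> ones (y (I m) j)" using y(3)[of "I m" j] by auto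
  ultimately have "1 / 4 < NID U (ones (I m), ones (y (I m) j))"
    using j c[OF j(1)] d[OF j(1)] by (intro NID_gt[where m = m and B = "2 * m + c + d"]) (auto simp: m_def)
  then show ?thesis using j(1) by blast
qed

section \<open>Fooling an approximation with a single descent\<close>

text \<open>The value is \<open>d / (b + 1)\<close> with \<open>d = int_decode a\<close>, so the
  condition reads \<open>b + 1 \<le> 4 * d\<close>. Even \<open>a\<close> encode the nonnegative
  \<open>d = a / 2\<close>, odd \<open>a\<close> the negative ones.\<close>

lemma rat_of_code_ge_iff:
  "1 / 4 \<le> rat_of_code n \<longleftrightarrow>
     fst (prod_decode n) mod 2 = 0 \<and> snd (prod_decode n) < 2 * fst (prod_decode n)"
proof -
  obtain a b where ab: "prod_decode n = (a, b)" by fastforce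
  have "1 / 4 \<le> rat_of_code n \<longleftrightarrow> of_nat (Suc b) \<le> (of_int (4 * int_decode a) :: rat)"
    by (simp add: rat_of_code_def ab divide_simps mult.commute)
  also have "\<dots> \<longleftrightarrow> int (Suc b) \<le> 4 * int_decode a"
    by (metis of_int_le_iff of_int_of_nat_eq)
  also have "\<dots> \<longleftrightarrow> a mod 2 = 0 \<and> b < 2 * a"
    by (auto simp: int_decode_def sum_decode_def elim!: evenE oddE)
  finally show ?thesis by (simp add: ab)
qed

lemma decidable_approx_ge:
  assumes "computable_approx f"
  shows "decidable 3 (\<lambda>xs. 1 / 4 \<le> f (ones (xs ! 0), ones (xs ! 1)) (xs ! 2))"
proof -
  obtain r F where F: "\<And>z s. reval r [pair_code z, s] (F z s)" "\<And>z s. rat_of_code (F z s) = f z s"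
    using assms unfolding computable_approx_def by metis
  have "recursive 3 (\<lambda>xs. pair_code (ones (xs ! 0), ones (xs ! 1)))"
    unfolding pair_code_def fst_conv snd_conv by (intro recursive_intros recursive_ones) auto
  then obtain p where p:
    "\<And>xs. length xs = 3 \<Longrightarrow> reval p xs (pair_code (ones (xs ! 0), ones (xs ! 1)))"
    unfolding recursive_def by blast
  have "reval (Comp r [p, Proj 2]) xs (F (ones (xs ! 0), ones (xs ! 1)) (xs ! 2))"
    if "length xs = 3" for xs
    by (rule reval.comp[OF _ F(1)]) (use that p proj[of 2 xs] in auto)
  then have "recursive 3 (\<lambda>xs. F (ones (xs ! 0), ones (xs ! 1)) (xs ! 2))"
    unfolding recursive_def by blast
  then have "decidable 3 (\<lambda>xs. 1 / 4 \<le> rat_of_code (F (ones (xs ! 0), ones (xs ! 1)) (xs ! 2)))"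
    unfolding rat_of_code_ge_iff by (intro recursive_intros)
  then show ?thesis by (simp add: F(2))
qed

text \<open>A strict drop from \<open>s\<close> to \<open>t\<close> is impossible before
  \<open>sz\<close>, so \<open>t\<close> lies in the descending phase and \<open>f t\<close> bounds
  all later values.\<close>

lemma unimodal_limit_le:
  fixes f :: "nat \<Rightarrow> rat"
  assumes up: "\<And>t t'. t \<le> t' \<Longrightarrow> t' < sz \<Longrightarrow> f t \<le> f t'"
    and down: "\<And>t t'. sz \<le> t \<Longrightarrow> t \<le> t' \<Longrightarrow> f t' \<le> f t"
    and lim: "(\<lambda>s. real_of_rat (f s)) \<longlonglongrightarrow> real_of_rat L"
    and "s \<le> t" "f t < f s"
  shows "L \<le> f t"
proof -
  have "sz \<le> t" using up[of s t] assms(4,5) by force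
  then have "\<forall>t'\<ge>t. real_of_rat (f t') \<le> real_of_rat (f t)"
    using down by (simp add: of_rat_less_eq)
  then have "real_of_rat L \<le> real_of_rat (f t)"
    using lim by (intro LIMSEQ_le_const2) auto
  then show ?thesis by (simp add: of_rat_less_eq)
qed

theorem mainTheorem7:
  assumes "universal_pf_machine U"
  shows "\<not> Sigma2 (NID U)"
proof
  assume "Sigma2 (NID U)"
  then obtain f where f: "is_approx f (NID U)" and
    unimodal: "\<And>z. \<exists>sz. (\<forall>t t'. t \<le> t' \<longrightarrow> t' < sz \<longrightarrow> f z t \<le> f z t') \<and>
               (\<forall>t t'. sz \<le> t \<longrightarrow> t \<le> t' \<longrightarrow> f z t' \<le> f z t)"
    unfolding Sigma2_def by blast
  have lim: "(\<lambda>s. real_of_rat (f z s)) \<longlonglongrightarrow> real_of_rat (NID U z)" for z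
    using f unfolding is_approx_def by blast
  define H where "H a b s \<longleftrightarrow> 1 / 4 \<le> f (ones a, ones b) s" for a b s
  have "recursive3 (\<lambda>a b s. of_bool (H a b s))"
    using f decidable_approx_ge unfolding is_approx_def H_def decidable_def recursive3_def by blast
  from recursive3_app[OF this] have decidable_H:
    "decidable k (\<lambda>xs. H (A xs) (B xs) (C xs))"
    if "recursive k A" "recursive k B" "recursive k C" for k A B C
    using that unfolding decidable_def by blast

  \<comment> \<open>The \<open>Suc\<close> keeps \<open>Y i j w\<close> different from
    \<open>i\<close>, since a pair code is at least its first component. The component
    \<open>j\<close> keeps the values for different \<open>j\<close> apart, whatever
    \<open>w\<close> is chosen for each.\<close>
  define Y where "Y i j w = Suc (prod_encode (i, prod_encode (j, w)))" for i j w
  \<comment> \<open>One search finds both a \<open>w\<close> and a stage at which the approximation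
    is high; the result codes this pair.\<close>
  define ws where "ws i j = (LEAST n. H i (Y i j (fst (prod_decode n))) (snd (prod_decode n)))" for i j
  define y where "y i j = Y i j (fst (prod_decode (ws i j)))" for i j
  define s where "s i j = snd (prod_decode (ws i j))" for i j
  have Y_neq: "Y i j w \<noteq> i" for i j w
    using le_prod_encode_1[of i "prod_encode (j, w)"] by (simp add: Y_def)
  have ex_ws: "\<exists>n. H i (Y i j (fst (prod_decode n))) (snd (prod_decode n))" for i j
  proof -
    have "recursive1 (Y i j)"
      unfolding recursive1_def Y_def by (intro recursive_intros) auto
    moreover have "inj (Y i j)" by (auto simp: inj_def Y_def)
    ultimately obtain w where "1 / 4 < NID U (ones i, ones (Y i j w))"
      using NID_gt_ex[OF assms] Y_neq by metis
    then have "real_of_rat (1 / 4) < real_of_rat (NID U (ones i, ones (Y i j w)))"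
      by (simp only: of_rat_less)
    from order_tendstoD(1)[OF lim this] obtain t where
      "real_of_rat (1 / 4) < real_of_rat (f (ones i, ones (Y i j w)) t)"
      by (auto simp: eventually_sequentially)
    then have "H i (Y i j w) t" unfolding of_rat_less H_def by simp
    then show ?thesis by (intro exI[of _ "prod_encode (w, t)"]) simp
  qed
  then have H_s: "H i (y i j) (s i j)" for i j
    unfolding y_def s_def ws_def by (rule LeastI_ex)
  have rec_ws: "recursive2 ws"
    unfolding ws_def
    by (rule recursive2_Least[OF _ ex_ws])
      (unfold Y_def, intro decidable_H recursive_intros, auto)
  have rec_y: "recursive2 y" and rec_s: "recursive2 s"
    unfolding y_def s_def Y_def recursive2_def
    by (intro recursive_intros recursive2_app[OF rec_ws]; simp)+

  \<comment> \<open>One search finds both \<open>i\<close> and a common stage at which the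
    approximation is low for all these \<open>j\<close>. Requiring the stage not to precede
    \<open>s i j\<close> ensures that the low value comes after the high one.\<close>
  define it where
    "it m = (LEAST n. \<forall>j<2 ^ m. \<not> H (fst (prod_decode n)) (y (fst (prod_decode n)) j) (snd (prod_decode n))
        \<and> s (fst (prod_decode n)) j \<le> snd (prod_decode n))" for m
  have ex_it: "\<exists>n. \<forall>j<2 ^ m. \<not> H (fst (prod_decode n)) (y (fst (prod_decode n)) j) (snd (prod_decode n))
        \<and> s (fst (prod_decode n)) j \<le> snd (prod_decode n)" for m
  proof -
    \<comment> \<open>This recovers \<open>i\<close> from \<open>y i j\<close>; the subtraction
      undoes the \<open>Suc\<close> in \<open>Y\<close>.\<close>
    have "recursive1 (\<lambda>n. fst (prod_decode (n - 1)))"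
      unfolding recursive1_def by (intro recursive_intros) simp
    moreover have "fst (prod_decode (y i j - 1)) = i" for i j by (simp add: y_def Y_def)
    ultimately obtain i where i: "\<And>j. j < 2 ^ m \<Longrightarrow> NID U (ones i, ones (y i j)) < 1 / 4"
      using NID_less_ex[OF assms rec_y] by metis
    have "eventually (\<lambda>t. \<not> H i (y i j) t \<and> s i j \<le> t) sequentially" if "j < 2 ^ m" for j
    proof (rule eventually_conj)
      have "real_of_rat (NID U (ones i, ones (y i j))) < real_of_rat (1 / 4)"
        using i[OF that] by (simp only: of_rat_less)
      from order_tendstoD(2)[OF lim this]
      show "eventually (\<lambda>t. \<not> H i (y i j) t) sequentially"
        unfolding of_rat_less H_def by (simp add: not_le)
    qed (rule eventually_ge_at_top)
    then have "eventually (\<lambda>t. \<forall>j\<in>{..<2 ^ m}. \<not> H i (y i j) t \<and> s i j \<le> t) sequentially"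
      by (intro eventually_ball_finite) auto
    then obtain t where "\<forall>j<2 ^ m. \<not> H i (y i j) t \<and> s i j \<le> t"
      by (auto simp: eventually_sequentially)
    then show ?thesis by (intro exI[of _ "prod_encode (i, t)"]) simp
  qed
  define I where "I m = fst (prod_decode (it m))" for m
  have it: "\<not> H (I m) (y (I m) j) (snd (prod_decode (it m)))" "s (I m) j \<le> snd (prod_decode (it m))"
    if "j < 2 ^ m" for m j
    using LeastI_ex[OF ex_it[of m]] that unfolding it_def[symmetric] I_def by blast+
  have "recursive1 it"
    unfolding it_def
    by (rule recursive1_Least[OF _ ex_it], rule decidable_ball_less)
      (intro decidable_H recursive_intros recursive2_app[OF rec_y] recursive2_app[OF rec_s]; simp)+
  then have rec_I: "recursive1 I"
    unfolding recursive1_def I_def by (rule recursive_fst_decode)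

  have "inj (y i)" for i by (auto simp: inj_def y_def Y_def)
  then obtain m j where j: "j < 2 ^ m" "1 / 4 < NID U (ones (I m), ones (y (I m) j))"
    using NID_gt_ex_star[OF assms rec_I rec_y] Y_neq unfolding y_def by metis
  let ?z = "(ones (I m), ones (y (I m) j))"
  have "f ?z (snd (prod_decode (it m))) < 1 / 4" "1 / 4 \<le> f ?z (s (I m) j)"
    using it(1)[OF j(1)] H_s[of "I m" j] unfolding H_def by auto
  \<comment> \<open>The approximation has dropped since stage \<open>s (I m) j\<close>, so it is in
    its descending phase and the limit is below 1/4, against the choice of \<open>j\<close>.\<close>
  moreover from this have "NID U ?z \<le> f ?z (snd (prod_decode (it m)))"
    using unimodal_limit_le[OF _ _ lim it(2)[OF j(1)]] unimodal[of ?z] by force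
  ultimately show False using j(2) by simp
qed

end
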